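(* Every $3$-dimensional right nilpotent right Leibniz algebra over $\mathbb C$ is dextral symmetric.
   Context: A right Leibniz algebra over a field $F$ is an $F$-vector space $L$ with a bilinear bracket $[\,,]:L\times L\to L$ satisfying $[a,[b,c]]=[[a,b],c]-[[a,c],b]$ for all $a,b,c\in L$. Let $L^{<1>}=L$ and $L^{<n+1>}=[L^{<n>},L]$ (span of brackets); $L$ is right nilpotent if $L^{<k>}=0$ for some $k\in\mathbb N$. $L$ is dextral symmetric if for all $a,b,c\in L$, $[a,[b,c]]=0$ implies $[b,[a,c]]=0$. *)

theory Defs
  imports Complex_Main
begin

(* The algebra is the whole type 'a; bilinearity of the bracket is linearity in
   each argument separately, with respect to the given scalar multiplication. *)
locale right_leibniz_algebra = vector_space scale
  for scale :: "'f::field \<Rightarrow> 'a::ab_group_add \<Rightarrow> 'a" +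
  fixes bracket :: "'a \<Rightarrow> 'a \<Rightarrow> 'a"
  assumes linear_right: "Vector_Spaces.linear scale scale (\<lambda>y. bracket x y)"
    and linear_left: "Vector_Spaces.linear scale scale (\<lambda>x. bracket x y)"
    and right_leibniz:
      "bracket a (bracket b c) = bracket (bracket a b) c - bracket (bracket a c) b"
begin

(* Indices are shifted by one: right_series n is L^{<n+1>}, so right_series 0 = L. *)
primrec right_series :: "nat \<Rightarrow> 'a set" where
  "right_series 0 = UNIV"
| "right_series (Suc n) = span {bracket x y | x y. x \<in> right_series n}"

definition right_nilpotent :: bool where
  "right_nilpotent \<longleftrightarrow> (\<exists>n. right_series n = {0})"

definition dextral_symmetric :: bool where
  "dextral_symmetric \<longleftrightarrow>
    (\<forall>a b c. bracket a (bracket b c) = 0 \<longrightarrow> bracket b (bracket a c) = 0)"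

end

end

theory Submission imports Defs begin

text \<open>
  Write \<open>L\<^sup>n\<close> for the terms of the right series. In fact \<open>[a,[b,c]] = 0\<close> holds identically.
  If \<open>L\<^sup>3 = 0\<close>, this is immediate from the Leibniz identity. Otherwise the inclusions
  \<open>L \<supset> L\<^sup>2 \<supset> L\<^sup>3 \<supset> 0\<close> are strict, so \<open>L\<^sup>2\<close> has codimension one and \<open>L = F x + L\<^sup>2\<close>. Since
  \<open>[a,[x,x]] = 0\<close> and the right annihilator \<open>R\<close> is an ideal, \<open>L\<^sup>2 \<subseteq> R + L\<^sup>n\<close> follows by induction
  on \<open>n\<close>, and nilpotency gives \<open>L\<^sup>2 \<subseteq> R\<close>.
\<close>

context right_leibniz_algebra
begin

sublocale left_mult: Vector_Spaces.linear scale scale "bracket x" for x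
  by (rule linear_right)

sublocale right_mult: Vector_Spaces.linear scale scale "\<lambda>x. bracket x y" for y
  by (rule linear_left)

lemma subspace_right_series: "subspace (right_series n)"
  by (cases n) simp_all

lemma bracket_right_series: "x \<in> right_series n \<Longrightarrow> bracket x y \<in> right_series (Suc n)"
  by (auto intro: span_base)

lemma right_series_Suc_subset: "right_series (Suc n) \<subseteq> right_series n"
proof (induction n)
  case (Suc n)
  then show ?case
    unfolding right_series.simps(2)[of "Suc n"] right_series.simps(2)[of n]
    by (intro span_mono) auto
qed simp

lemma right_series_antimono: "m \<le> n \<Longrightarrow> right_series n \<subseteq> right_series m"
  using right_series_Suc_subset by (rule lift_Suc_antimono_le)

lemma right_series_stationary:
  assumes "right_series (Suc n) = right_series n"
  shows "right_series (n + k) = right_series n"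
proof (induction k)
  case (Suc k)
  then show ?case using assms by simp
qed simp

text \<open>If two consecutive terms agreed, the series would be constant from there on and could
  never come down to the zero space.\<close>

lemma right_series_strict:
  assumes "right_nilpotent" and "right_series n \<noteq> {0}"
  shows "right_series (Suc n) \<subset> right_series n"
proof -
  obtain m where m: "right_series m = {0}"
    using assms(1) unfolding right_nilpotent_def by blast
  have "right_series (n + m) \<subseteq> {0}"
    using right_series_antimono[of m "n + m"] m by simp
  moreover have "0 \<in> right_series n"
    by (simp add: subspace_0 subspace_right_series)
  ultimately have "right_series (Suc n) \<noteq> right_series n"
    using right_series_stationary[of n m] assms(2) by blast
  then show ?thesis using right_series_Suc_subset by blast
qed

text \<open>Needed because membership in the series is built in only for brackets whose left factor
  is deep; the Leibniz identity moves depth from the right factor to the left. With the index shift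
  this reads [L^i, L^j] \<subseteq> L^(i+j).\<close>

lemma bracket_right_series_right_series:
  "x \<in> right_series m \<Longrightarrow> y \<in> right_series n \<Longrightarrow> bracket x y \<in> right_series (Suc (m + n))"
proof (induction n arbitrary: m x y)
  case 0
  then show ?case using bracket_right_series[of x m y] by simp
next
  case (Suc n)
  let ?T = "right_series (Suc (m + Suc n))"
  \<comment> \<open>For fixed \<open>x\<close> the admissible \<open>y\<close> form a subspace, so
    only the generators \<open>bracket u v\<close> have to be tested.\<close>
  have "subspace {y. bracket x y \<in> ?T}"
    using left_mult.subspace_vimage[OF subspace_right_series] by (simp add: vimage_def del: right_series.simps)
  moreover have "bracket x (bracket u v) \<in> ?T" if "u \<in> right_series n" for u v
  proof -
    have "bracket (bracket x u) v \<in> ?T"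
      using bracket_right_series[OF Suc.IH[OF Suc.prems(1) that]] by (simp del: right_series.simps)
    \<comment> \<open>Here the induction hypothesis is applied at \<open>Suc m\<close>, which is why
      \<open>m\<close> is generalised.\<close>
    moreover have "bracket (bracket x v) u \<in> ?T"
      using Suc.IH[OF bracket_right_series[OF Suc.prems(1)] that] by (simp del: right_series.simps)
    ultimately show ?thesis
      unfolding right_leibniz[of x u v] by (rule subspace_diff[OF subspace_right_series])
  qed
  ultimately have "right_series (Suc n) \<subseteq> {y. bracket x y \<in> ?T}"
    unfolding right_series.simps(2)[of n] by (intro span_minimal) auto
  with Suc.prems(2) show ?case by blast
qed

definition right_annihilator :: "'a set" where
  "right_annihilator = {y. \<forall>x. bracket x y = 0}"

lemma subspace_right_annihilator: "subspace right_annihilator"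
  unfolding right_annihilator_def
  by (auto simp: subspace_def left_mult.add left_mult.scale)

lemma bracket_right_annihilator: "y \<in> right_annihilator \<Longrightarrow> bracket x y = 0"
  by (simp add: right_annihilator_def)

text \<open>In [x,[y,z]] = [[x,y],z] - [[x,z],y] both terms contain a bracket with \<open>y\<close>
  on the right.\<close>

lemma right_annihilator_ideal: "y \<in> right_annihilator \<Longrightarrow> bracket y z \<in> right_annihilator"
  by (simp add: right_annihilator_def right_leibniz right_mult.zero)

text \<open>The two terms of the Leibniz identity coincide when b = c, so they cancel.\<close>

lemma square_right_annihilator: "bracket x x \<in> right_annihilator"
  by (simp add: right_annihilator_def right_leibniz)

text \<open>Each induction step pushes the error \<open>s\<close> one term deeper into the series.
  The hypothesis on \<open>x\<close> says L = F x + L^2.\<close>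

lemma derived_subset_right_annihilator_plus:
  assumes x: "\<And>p. \<exists>k. p - scale k x \<in> right_series 1"
    and "y \<in> right_series 1"
  shows "\<exists>s\<in>right_series n. y - s \<in> right_annihilator"
  using assms(2)
proof (induction n arbitrary: y)
  case 0
  show ?case
    using subspace_0[OF subspace_right_annihilator] by (intro bexI[of _ y]) auto
next
  case (Suc n)
  let ?S = "right_series (Suc n)" and ?R = right_annihilator
  let ?W = "{a + b | a b. a \<in> ?R \<and> b \<in> ?S}"
  have "subspace ?W"
    by (rule subspace_sums[OF subspace_right_annihilator subspace_right_series])
  moreover have "bracket p q \<in> ?W" for p q
  proof -
    \<comment> \<open>Both factors become a multiple of \<open>x\<close>, plus an element of
      \<open>?R\<close>, plus an error in \<open>right_series n\<close>; the induction hypothesis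
      applies to their L^2 parts.\<close>
    obtain k l where k: "p - scale k x \<in> right_series 1" and l: "q - scale l x \<in> right_series 1"
      using x by meson
    obtain s where s: "s \<in> right_series n" "p - scale k x - s \<in> ?R"
      using Suc.IH[OF k] by blast
    obtain t where t: "t \<in> right_series n" "q - scale l x - t \<in> ?R"
      using Suc.IH[OF l] by blast
    define r where "r = p - scale k x - s"
    define r' where "r' = q - scale l x - t"
    have p: "p = scale k x + (r + s)" and q: "q = r' + (scale l x + t)"
      by (simp_all add: r_def r'_def)
    \<comment> \<open>On the right, \<open>r'\<close> is annihilated. On the left, \<open>r\<close>
      survives, but \<open>bracket r x\<close> stays in \<open>?R\<close> by the ideal
      property.\<close>
    have "bracket p q = bracket p (scale l x + t)"
      using t(2) by (simp add: q left_mult.add bracket_right_annihilator flip: r'_def)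
    also have "\<dots> = bracket p t + scale l (bracket p x)"
      by (simp add: left_mult.add left_mult.scale add.commute)
    also have "bracket p x = scale k (bracket x x) + bracket r x + bracket s x"
      by (simp add: p right_mult.add right_mult.scale add.assoc)
    finally have "bracket p q = scale l (scale k (bracket x x) + bracket r x)
      + (bracket p t + scale l (bracket s x))"
      by (simp add: scale_right_distrib algebra_simps)
    moreover have "scale l (scale k (bracket x x) + bracket r x) \<in> ?R"
      using s(2) subspace_right_annihilator
      by (intro subspace_scale subspace_add square_right_annihilator right_annihilator_ideal)
        (simp_all add: r_def)
    moreover have "bracket p t + scale l (bracket s x) \<in> ?S"
      \<comment> \<open>The error \<open>t\<close> stands on the right, so the two-sided estimate is
        used with \<open>p\<close> in \<open>right_series 0\<close>, the whole algebra.\<close>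
      using bracket_right_series_right_series[of p 0 t n] bracket_right_series[OF s(1), of x] t(1)
        subspace_right_series[of "Suc n"]
      by (intro subspace_add subspace_scale) simp_all
    ultimately show ?thesis by blast
  qed
  ultimately have "right_series 1 \<subseteq> ?W"
    unfolding One_nat_def right_series.simps(2)[of 0] by (intro span_minimal) auto
  with Suc.prems obtain a b where "y = a + b" "a \<in> ?R" "b \<in> ?S" by blast
  then show ?case by (intro bexI[of _ b]) auto
qed

lemma derived_subset_right_annihilator:
  assumes "right_nilpotent" and "\<And>p. \<exists>k. p - scale k x \<in> right_series 1"
  shows "right_series 1 \<subseteq> right_annihilator"
proof
  fix y assume "y \<in> right_series 1"
  moreover obtain n where "right_series n = {0}"
    using assms(1) unfolding right_nilpotent_def by blast
  ultimately show "y \<in> right_annihilator"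
    using derived_subset_right_annihilator_plus[OF assms(2), of y n] by simp
qed

text \<open>Because of the index shift, \<open>right_series 2\<close> is L^3, which contains both
  terms on the right of the Leibniz identity.\<close>

lemma bracket_bracket_eq_0_if_class_le_2:
  assumes "right_series 2 = {0}"
  shows "bracket a (bracket b c) = 0"
proof -
  have "bracket (bracket u v) w = 0" for u v w
    using bracket_right_series[OF bracket_right_series[of u 0 v], of w] assms
    by (simp add: numeral_2_eq_2)
  then show ?thesis by (simp add: right_leibniz)
qed

text \<open>The strict chain L^2 \<supset> L^3 \<supset> 0 gives dim L^2 \<ge> 2, so L^2 and any
  vector outside it span the 3-dimensional algebra.\<close>

lemma derived_codim_1:
  assumes dim: "dim (UNIV :: 'a set) = 3" and nil: "right_nilpotent"
    and L3: "right_series 2 \<noteq> {0}"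
  obtains x where "\<And>p. \<exists>k. p - scale k x \<in> right_series 1"
proof -
  obtain B where B: "independent B" "UNIV \<subseteq> span B" "card B = dim (UNIV :: 'a set)"
    using basis_exists by blast
  \<comment> \<open>An infinite set has \<open>card\<close> 0 by convention, whereas
    \<open>card B\<close> is 3.\<close>
  then have "finite B" using dim card.infinite by fastforce
  with B interpret fd: finite_dimensional_vector_space scale B
    by unfold_locales auto
  have span_series: "span (right_series n) = right_series n" for n
    by (simp add: subspace_right_series span_eq_iff)
  have zero: "0 \<in> right_series n" for n
    by (simp add: subspace_0 subspace_right_series)
  have L1: "right_series 1 \<noteq> {0}"
    using L3 right_series_antimono[of 1 2] zero[of 2] by fastforce
  then have L0: "right_series 0 \<noteq> {0}"
    using right_series_antimono[of 0 1] zero[of 1] by fastforce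
  have "dim (right_series 2) \<noteq> 0"
    using L3 zero[of 2] unfolding fd.dim_eq_0 by blast
  moreover have "dim (right_series 2) < dim (right_series 1)"
    using right_series_strict[OF nil L1]
    by (intro fd.dim_psubset) (simp add: span_series numeral_2_eq_2 del: right_series.simps)
  ultimately have ge: "dim (right_series 1) \<ge> 2" by linarith
  obtain x where x: "x \<notin> right_series 1"
    using right_series_strict[OF nil L0] by auto
  have "dim (insert x (right_series 1)) \<ge> dim (UNIV :: 'a set)"
    using x ge dim by (simp add: fd.dim_insert span_series del: fd.dim_UNIV right_series.simps)
  then have "span (insert x (right_series 1)) = UNIV"
    using fd.dim_eq_span[OF subset_UNIV] by (metis span_UNIV)
  then have "\<exists>k. p - scale k x \<in> right_series 1" for p
    using span_breakdown_eq[of p x "right_series 1"] by (simp add: span_series del: right_series.simps)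
  then show thesis by (rule that)
qed

end

theorem proposition5p2:
  fixes scale :: "complex \<Rightarrow> 'a::ab_group_add \<Rightarrow> 'a"
    and bracket :: "'a \<Rightarrow> 'a \<Rightarrow> 'a"
  assumes "right_leibniz_algebra scale bracket"
    and "vector_space.dim scale (UNIV :: 'a set) = 3"
    and "right_leibniz_algebra.right_nilpotent scale bracket"
  shows "right_leibniz_algebra.dextral_symmetric bracket"
proof -
  interpret right_leibniz_algebra scale bracket by fact
  have "bracket a (bracket b c) = 0" for a b c
  proof (cases "right_series 2 = {0}")
    case True
    then show ?thesis by (rule bracket_bracket_eq_0_if_class_le_2)
  next
    case False
    then obtain x where "\<And>p. \<exists>k. p - scale k x \<in> right_series 1"
      using derived_codim_1 assms(2,3) by blast
    then have "right_series 1 \<subseteq> right_annihilator"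
      by (rule derived_subset_right_annihilator[OF assms(3)])
    moreover have "bracket b c \<in> right_series 1"
      using bracket_right_series[of b 0 c] by simp
    ultimately show ?thesis using bracket_right_annihilator by blast
  qed
  then show ?thesis unfolding dextral_symmetric_def by blast
qed

end
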